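(* For $n\geq1$, $a_n(312,4321:132)=T_{n+2}+T_{n+1}-1$, where $T_n$ is the $n$-th Tribonacci number.
   Context: $\mathcal{S}_n$ is the set of permutations of $\{1,\ldots,n\}$ in one-line form; $\pi^2=\pi\circ\pi$. A permutation contains a pattern $\sigma\in\mathcal{S}_k$ if some subsequence of it (not necessarily consecutive) has the same relative order as $\sigma$; otherwise it avoids $\sigma$. $a_n(312,4321:\sigma)$ is the number of $\pi\in\mathcal{S}_n$ such that $\pi$ avoids both $312$ and $4321$ and $\pi^2$ avoids $\sigma$. Tribonacci numbers: $T_0=T_1=0$, $T_2=1$, $T_n=T_{n-1}+T_{n-2}+T_{n-3}$ for $n\ge3$. *)

theory Defs
  imports "HOL-Combinatorics.Permutations" "HOL-Library.Sublist"
begin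

text \<open>
  Permutations of \<open>{1..n}\<close> are functions \<open>\<pi>\<close> with \<open>\<pi> permutes {1..n}\<close> (hence the identity
  outside \<open>{1..n}\<close>), so that \<open>\<pi>\<^sup>2\<close> is \<open>\<pi> \<circ> \<pi>\<close>. Patterns are given in one-line form.
\<close>

definition one_line :: "nat \<Rightarrow> (nat \<Rightarrow> nat) \<Rightarrow> nat list" where
  "one_line n \<pi> = map \<pi> [1..<Suc n]"

definition same_relative_order :: "nat list \<Rightarrow> nat list \<Rightarrow> bool" where
  "same_relative_order v \<sigma> \<longleftrightarrow> length v = length \<sigma> \<and>
     (\<forall>i<length \<sigma>. \<forall>j<length \<sigma>. v ! i < v ! j \<longleftrightarrow> \<sigma> ! i < \<sigma> ! j)"

definition contains_pattern :: "nat list \<Rightarrow> nat list \<Rightarrow> bool" where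
  "contains_pattern w \<sigma> \<longleftrightarrow> (\<exists>v. subseq v w \<and> same_relative_order v \<sigma>)"

abbreviation avoids_pattern :: "nat list \<Rightarrow> nat list \<Rightarrow> bool" where
  "avoids_pattern w \<sigma> \<equiv> \<not> contains_pattern w \<sigma>"

text \<open>\<open>count_avoid_sq n \<Sigma> \<sigma>\<close> is $a_n(\Sigma : \sigma)$.\<close>

definition count_avoid_sq :: "nat \<Rightarrow> nat list set \<Rightarrow> nat list \<Rightarrow> nat" where
  "count_avoid_sq n \<Sigma> \<sigma> =
     card {\<pi>. \<pi> permutes {1..n} \<and>
              (\<forall>\<tau>\<in>\<Sigma>. avoids_pattern (one_line n \<pi>) \<tau>) \<and>
              avoids_pattern (one_line n (\<pi> \<circ> \<pi>)) \<sigma>}"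

fun tribonacci :: "nat \<Rightarrow> nat" where
  "tribonacci 0 = 0"
| "tribonacci (Suc 0) = 0"
| "tribonacci (Suc (Suc 0)) = 1"
| "tribonacci (Suc (Suc (Suc n))) =
     tribonacci (Suc (Suc n)) + tribonacci (Suc n) + tribonacci n"

end

theory Submission
  imports Defs
begin

text \<open>
  Let \<open>\<pi>\<close> avoid 312 and let \<open>k\<close> be the position of its entry 1. An entry before position \<open>k\<close>
  exceeding an entry after it would form a 312 with the 1 between them, so \<open>\<pi>\<close> is a direct sum
  \<open>\<sigma> \<oplus> \<tau>\<close> in which the first summand \<open>\<sigma>\<close> has length \<open>k\<close> and ends in 1. Neither 312 nor 4321 is a
  direct sum of shorter patterns, so \<open>\<pi>\<close> avoids them exactly when \<open>\<sigma>\<close> and \<open>\<tau>\<close> do. Moreover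
  \<open>\<pi>\<^sup>2 = \<sigma>\<^sup>2 \<oplus> \<tau>\<^sup>2\<close>, and since any entry of \<open>\<sigma>\<^sup>2\<close> can serve as the 1 of a 132, the permutation
  \<open>\<pi>\<^sup>2\<close> avoids 132 exactly when \<open>\<sigma>\<^sup>2\<close> does and \<open>\<tau>\<^sup>2\<close> is the identity. So the number sought is the
  sum over \<open>k\<close> of the number of admissible \<open>\<sigma>\<close> of length \<open>k\<close> times the number of admissible
  involutions \<open>\<tau>\<close> of length \<open>n - k\<close> (\<open>card_avoiders_by_leading_block\<close>).

  The same splitting counts the involutions: an involution ending in 1 starts with its
  largest entry, so avoiding 312 makes it decreasing and avoiding 4321 leaves 1, 21 and 321 only.
  The three possible lengths of the first summand give the Tribonacci recurrence
  (\<open>card_involutive_avoiders\<close>).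

  For \<open>k \<ge> 3\<close> there are exactly two admissible \<open>\<sigma>\<close>
  (\<open>leading_block_classification\<close>): the cycle \<open>2 3 \<dots> k 1\<close> and the same word with one
  adjacent pair of entries exchanged, namely 321, 3241, or \<open>2 4 3 5 \<dots> k 1\<close> for \<open>k \<ge> 5\<close>.
  Since \<open>\<sigma>\<close> ends in 1, the square of \<open>\<sigma>\<close> ends in the first entry of \<open>\<sigma>\<close>, which must be 2 or 3; every
  larger entry of \<open>\<sigma>\<^sup>2\<close> must then occur before the 1, and the entries of \<open>\<sigma>\<^sup>2\<close> exceeding its first one
  must increase. This leaves so little freedom that \<open>\<sigma>\<close> is determined entry by entry.

  With one admissible \<open>\<sigma>\<close> for each of \<open>k = 1\<close>, \<open>k = 2\<close> and two for every larger \<open>k\<close>, what remains is a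
  summation formula for Tribonacci numbers (\<open>weighted_sum_tribonacci\<close>).
\<close>

section \<open>Pattern containment in terms of positions\<close>

text \<open>
  Peeling off one letter at a time turns the choice of a subsequence into the choice of increasing
  positions, so that patterns can be handled by comparing function values only.
\<close>

lemma subseq_Cons_map_upt:
  "subseq (x # v) (map f [a..<b]) \<longleftrightarrow> (\<exists>i. a \<le> i \<and> i < b \<and> f i = x \<and> subseq v (map f [Suc i..<b]))"
proof
  assume "subseq (x # v) (map f [a..<b])"
  then obtain us y vs where 1: "map f [a..<b] = us @ y # vs" "x = y" "subseq v vs"
    by (auto dest: list_emb_ConsD)
  define i where "i = a + length us"
  have "length (map f [a..<b]) = length us + Suc (length vs)" using 1(1) by simp
  hence i: "a \<le> i" "i < b" unfolding i_def by auto
  have "f i = map f [a..<b] ! length us" using i unfolding i_def by simp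
  hence "f i = x" using 1 by simp
  moreover have "vs = drop (Suc (length us)) (map f [a..<b])" using 1(1) by simp
  hence "vs = map f [Suc i..<b]" unfolding i_def by (simp add: drop_map)
  ultimately show "\<exists>i. a \<le> i \<and> i < b \<and> f i = x \<and> subseq v (map f [Suc i..<b])" using i 1(3) by auto
next
  assume "\<exists>i. a \<le> i \<and> i < b \<and> f i = x \<and> subseq v (map f [Suc i..<b])"
  then obtain i where i: "a \<le> i" "i < b" "f i = x" "subseq v (map f [Suc i..<b])" by auto
  have "[a..<b] = [a..<i] @ i # [Suc i..<b]"
    using i upt_add_eq_append[of a i "b - i"] by (simp add: upt_conv_Cons)
  thus "subseq (x # v) (map f [a..<b])"
    using i by (simp add: list_emb_append2 subseq_Cons2)
qed

definition has_132 :: "nat \<Rightarrow> (nat \<Rightarrow> nat) \<Rightarrow> bool" where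
  "has_132 n f \<longleftrightarrow> (\<exists>i j l. 1 \<le> i \<and> i < j \<and> j < l \<and> l \<le> n \<and> f i < f l \<and> f l < f j)"

definition has_312 :: "nat \<Rightarrow> (nat \<Rightarrow> nat) \<Rightarrow> bool" where
  "has_312 n f \<longleftrightarrow> (\<exists>i j l. 1 \<le> i \<and> i < j \<and> j < l \<and> l \<le> n \<and> f j < f l \<and> f l < f i)"

definition has_4321 :: "nat \<Rightarrow> (nat \<Rightarrow> nat) \<Rightarrow> bool" where
  "has_4321 n f \<longleftrightarrow> (\<exists>i j l m. 1 \<le> i \<and> i < j \<and> j < l \<and> l < m \<and> m \<le> n \<and>
     f m < f l \<and> f l < f j \<and> f j < f i)"

lemma contains_pattern_length_3:
  "contains_pattern (one_line n f) [a, b, c] \<longleftrightarrow>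
     (\<exists>i j l. 1 \<le> i \<and> i < j \<and> j < l \<and> l \<le> n \<and> same_relative_order [f i, f j, f l] [a, b, c])"
proof
  assume "contains_pattern (one_line n f) [a, b, c]"
  then obtain v where v: "subseq v (map f [1..<Suc n])" "same_relative_order v [a, b, c]"
    unfolding contains_pattern_def one_line_def by auto
  from v(2) have "length v = Suc (Suc (Suc 0))" by (simp add: same_relative_order_def)
  then obtain x y z where "v = [x, y, z]" by (auto simp: length_Suc_conv)
  thus "\<exists>i j l. 1 \<le> i \<and> i < j \<and> j < l \<and> l \<le> n \<and> same_relative_order [f i, f j, f l] [a, b, c]"
    using v by (fastforce simp: subseq_Cons_map_upt Suc_le_eq less_Suc_eq_le simp del: upt_Suc)
next
  assume "\<exists>i j l. 1 \<le> i \<and> i < j \<and> j < l \<and> l \<le> n \<and> same_relative_order [f i, f j, f l] [a, b, c]"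
  then obtain i j l where "1 \<le> i" "i < j" "j < l" "l \<le> n"
    and r: "same_relative_order [f i, f j, f l] [a, b, c]" by auto
  hence "subseq [f i, f j, f l] (map f [1..<Suc n])"
    unfolding subseq_Cons_map_upt by (intro exI[of _ i] exI[of _ j] exI[of _ l] conjI) auto
  thus "contains_pattern (one_line n f) [a, b, c]" using r
    unfolding contains_pattern_def one_line_def by auto
qed

lemma contains_pattern_length_4:
  "contains_pattern (one_line n f) [a, b, c, d] \<longleftrightarrow>
     (\<exists>i j l m. 1 \<le> i \<and> i < j \<and> j < l \<and> l < m \<and> m \<le> n \<and>
        same_relative_order [f i, f j, f l, f m] [a, b, c, d])"
proof
  assume "contains_pattern (one_line n f) [a, b, c, d]"
  then obtain v where v: "subseq v (map f [1..<Suc n])" "same_relative_order v [a, b, c, d]"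
    unfolding contains_pattern_def one_line_def by auto
  from v(2) have "length v = Suc (Suc (Suc (Suc 0)))" by (simp add: same_relative_order_def)
  then obtain x y z w where "v = [x, y, z, w]" by (auto simp: length_Suc_conv)
  thus "\<exists>i j l m. 1 \<le> i \<and> i < j \<and> j < l \<and> l < m \<and> m \<le> n \<and>
        same_relative_order [f i, f j, f l, f m] [a, b, c, d]"
    using v by (fastforce simp: subseq_Cons_map_upt Suc_le_eq less_Suc_eq_le simp del: upt_Suc)
next
  assume "\<exists>i j l m. 1 \<le> i \<and> i < j \<and> j < l \<and> l < m \<and> m \<le> n \<and>
        same_relative_order [f i, f j, f l, f m] [a, b, c, d]"
  then obtain i j l m where "1 \<le> i" "i < j" "j < l" "l < m" "m \<le> n"
    and r: "same_relative_order [f i, f j, f l, f m] [a, b, c, d]" by auto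
  hence "subseq [f i, f j, f l, f m] (map f [1..<Suc n])"
    unfolding subseq_Cons_map_upt by (intro exI[of _ i] exI[of _ j] exI[of _ l] exI[of _ m] conjI) auto
  thus "contains_pattern (one_line n f) [a, b, c, d]" using r
    unfolding contains_pattern_def one_line_def by auto
qed

lemma contains_pattern_iff:
  shows contains_132_iff: "contains_pattern (one_line n f) [1, 3, 2] \<longleftrightarrow> has_132 n f"
    and contains_312_iff: "contains_pattern (one_line n f) [3, 1, 2] \<longleftrightarrow> has_312 n f"
    and contains_4321_iff: "contains_pattern (one_line n f) [4, 3, 2, 1] \<longleftrightarrow> has_4321 n f"
proof -
  have "same_relative_order [x, y, z] [1, 3, 2] \<longleftrightarrow> x < z \<and> z < y"
       "same_relative_order [x, y, z] [3, 1, 2] \<longleftrightarrow> y < z \<and> z < x" for x y z :: nat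
    by (auto simp: same_relative_order_def All_less_Suc numeral_eq_Suc)
  thus "contains_pattern (one_line n f) [1, 3, 2] \<longleftrightarrow> has_132 n f"
    "contains_pattern (one_line n f) [3, 1, 2] \<longleftrightarrow> has_312 n f"
    by (simp_all add: contains_pattern_length_3 has_132_def has_312_def)
  have "same_relative_order [x, y, z, w] [4, 3, 2, 1] \<longleftrightarrow> w < z \<and> z < y \<and> y < x" for x y z w :: nat
    by (auto simp: same_relative_order_def All_less_Suc numeral_eq_Suc)
  thus "contains_pattern (one_line n f) [4, 3, 2, 1] \<longleftrightarrow> has_4321 n f"
    by (simp add: contains_pattern_length_4 has_4321_def)
qed

section \<open>Direct sums and the block ending in 1\<close>

lemma permutesI_inj_on:
  assumes "finite S" "\<And>x. x \<in> S \<Longrightarrow> f x \<in> S" "inj_on f S" "\<And>x. x \<notin> S \<Longrightarrow> f x = x"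
  shows "f permutes S"
proof -
  have "f ` S = S" using assms(1-3) by (intro endo_inj_surj) auto
  thus ?thesis using assms by (intro bij_imp_permutes) (auto simp: bij_betw_def)
qed

text \<open>
  Only the length of the first summand is needed, because both summands are the identity beyond
  their length; the sum of permutations of lengths \<open>k\<close> and \<open>m\<close> has length \<open>k + m\<close>.
\<close>

definition direct_sum :: "nat \<Rightarrow> (nat \<Rightarrow> nat) \<Rightarrow> (nat \<Rightarrow> nat) \<Rightarrow> nat \<Rightarrow> nat" where
  "direct_sum k \<sigma> \<tau> i = (if i \<le> k then \<sigma> i else k + \<tau> (i - k))"

lemma permutes_atLeast1_bounds:
  fixes \<sigma> :: "nat \<Rightarrow> nat"
  assumes "\<sigma> permutes {1..k}"
  shows "\<sigma> i \<le> k \<longleftrightarrow> i \<le> k" and "1 \<le> \<sigma> i \<longleftrightarrow> 1 \<le> i"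
proof -
  have "\<sigma> i \<in> {1..k} \<longleftrightarrow> i \<in> {1..k}" using assms by (rule permutes_in_image)
  moreover have "i \<notin> {1..k} \<Longrightarrow> \<sigma> i = i" for i using assms by (rule permutes_not_in)
  ultimately show "\<sigma> i \<le> k \<longleftrightarrow> i \<le> k" "1 \<le> \<sigma> i \<longleftrightarrow> 1 \<le> i"
    by (cases "i \<in> {1..k}"; force)+
qed

context
  fixes k m :: nat and \<sigma> \<tau> :: "nat \<Rightarrow> nat"
  assumes \<sigma>: "\<sigma> permutes {1..k}" and \<tau>: "\<tau> permutes {1..m}"
begin

text \<open>
  The first summand occupies both the first positions and the smallest values; this makes an
  occurrence of an indecomposable pattern stay inside one summand.
\<close>

lemma direct_sum_le_iff: "direct_sum k \<sigma> \<tau> i \<le> k \<longleftrightarrow> i \<le> k"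
  using permutes_atLeast1_bounds[OF \<sigma>, of i] permutes_atLeast1_bounds[OF \<tau>, of "i - k"]
  by (auto simp: direct_sum_def)

lemma direct_sum_permutes: "direct_sum k \<sigma> \<tau> permutes {1..k + m}"
proof (rule permutesI_inj_on)
  fix x
  show "direct_sum k \<sigma> \<tau> x \<in> {1..k + m}" if "x \<in> {1..k + m}"
    using that permutes_atLeast1_bounds[OF \<sigma>, of x] permutes_atLeast1_bounds[OF \<tau>, of "x - k"]
    by (auto simp: direct_sum_def)
  show "direct_sum k \<sigma> \<tau> x = x" if "x \<notin> {1..k + m}"
  proof -
    from that consider "x = 0" | "k < x" "x - k \<notin> {1..m}" by fastforce
    thus ?thesis
      using permutes_atLeast1_bounds(2)[OF \<sigma>, of 0] permutes_not_in[OF \<tau>, of "x - k"]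
      by cases (auto simp: direct_sum_def)
  qed
next
  have *: "x = y" if "direct_sum k \<sigma> \<tau> x = direct_sum k \<sigma> \<tau> y" for x y
  proof (cases "x \<le> k")
    case True
    hence "y \<le> k" using that direct_sum_le_iff by metis
    thus ?thesis using that True permutes_inj[OF \<sigma>] by (auto simp: direct_sum_def inj_def)
  next
    case False
    hence y: "\<not> y \<le> k" using that direct_sum_le_iff by metis
    hence "\<tau> (x - k) = \<tau> (y - k)" using that False by (auto simp: direct_sum_def)
    hence "x - k = y - k" using permutes_inj[OF \<tau>] by (auto simp: inj_def)
    thus ?thesis using y False by linarith
  qed
  thus "inj_on (direct_sum k \<sigma> \<tau>) {1..k + m}" by (auto simp: inj_on_def)
qed auto

lemma direct_sum_square:
  "direct_sum k \<sigma> \<tau> \<circ> direct_sum k \<sigma> \<tau> = direct_sum k (\<sigma> \<circ> \<sigma>) (\<tau> \<circ> \<tau>)"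
proof
  fix i
  show "(direct_sum k \<sigma> \<tau> \<circ> direct_sum k \<sigma> \<tau>) i = direct_sum k (\<sigma> \<circ> \<sigma>) (\<tau> \<circ> \<tau>) i"
    using permutes_atLeast1_bounds[OF \<sigma>, of i] permutes_atLeast1_bounds[OF \<tau>, of "i - k"]
    by (auto simp: direct_sum_def)
qed

lemma has_312_direct_sum:
  "has_312 (k + m) (direct_sum k \<sigma> \<tau>) \<longleftrightarrow> has_312 k \<sigma> \<or> has_312 m \<tau>" (is "?L \<longleftrightarrow> ?R")
proof
  assume ?L
  then obtain i j l where h: "1 \<le> i" "i < j" "j < l" "l \<le> k + m"
    "direct_sum k \<sigma> \<tau> j < direct_sum k \<sigma> \<tau> l" "direct_sum k \<sigma> \<tau> l < direct_sum k \<sigma> \<tau> i"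
    unfolding has_312_def by auto
  show ?R
  proof (cases "i \<le> k")
    case True
    hence "direct_sum k \<sigma> \<tau> l \<le> k" using h direct_sum_le_iff[of i] by linarith
    hence "l \<le> k" by (simp add: direct_sum_le_iff)
    hence "has_312 k \<sigma>" using h unfolding has_312_def
      by (intro exI[of _ i] exI[of _ j] exI[of _ l]) (auto simp: direct_sum_def)
    thus ?thesis ..
  next
    case False
    hence "has_312 m \<tau>" using h unfolding has_312_def
      by (intro exI[of _ "i - k"] exI[of _ "j - k"] exI[of _ "l - k"]) (auto simp: direct_sum_def)
    thus ?thesis ..
  qed
next
  assume ?R
  thus ?L
  proof
    assume "has_312 k \<sigma>"
    then obtain i j l where "1 \<le> i" "i < j" "j < l" "l \<le> k" "\<sigma> j < \<sigma> l" "\<sigma> l < \<sigma> i"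
      unfolding has_312_def by auto
    thus ?L unfolding has_312_def
      by (intro exI[of _ i] exI[of _ j] exI[of _ l]) (auto simp: direct_sum_def)
  next
    assume "has_312 m \<tau>"
    then obtain i j l where "1 \<le> i" "i < j" "j < l" "l \<le> m" "\<tau> j < \<tau> l" "\<tau> l < \<tau> i"
      unfolding has_312_def by auto
    thus ?L unfolding has_312_def
      by (intro exI[of _ "k + i"] exI[of _ "k + j"] exI[of _ "k + l"]) (auto simp: direct_sum_def)
  qed
qed

lemma has_4321_direct_sum:
  "has_4321 (k + m) (direct_sum k \<sigma> \<tau>) \<longleftrightarrow> has_4321 k \<sigma> \<or> has_4321 m \<tau>" (is "?L \<longleftrightarrow> ?R")
proof
  assume ?L
  then obtain i j l p where h: "1 \<le> i" "i < j" "j < l" "l < p" "p \<le> k + m"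
    "direct_sum k \<sigma> \<tau> p < direct_sum k \<sigma> \<tau> l" "direct_sum k \<sigma> \<tau> l < direct_sum k \<sigma> \<tau> j"
    "direct_sum k \<sigma> \<tau> j < direct_sum k \<sigma> \<tau> i"
    unfolding has_4321_def by auto
  show ?R
  proof (cases "i \<le> k")
    case True
    hence "direct_sum k \<sigma> \<tau> p \<le> k" using h direct_sum_le_iff[of i] by linarith
    hence "p \<le> k" by (simp add: direct_sum_le_iff)
    hence "has_4321 k \<sigma>" using h unfolding has_4321_def
      by (intro exI[of _ i] exI[of _ j] exI[of _ l] exI[of _ p]) (auto simp: direct_sum_def)
    thus ?thesis ..
  next
    case False
    hence "has_4321 m \<tau>" using h unfolding has_4321_def
      by (intro exI[of _ "i - k"] exI[of _ "j - k"] exI[of _ "l - k"] exI[of _ "p - k"])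
        (auto simp: direct_sum_def)
    thus ?thesis ..
  qed
next
  assume ?R
  thus ?L
  proof
    assume "has_4321 k \<sigma>"
    then obtain i j l p where "1 \<le> i" "i < j" "j < l" "l < p" "p \<le> k" "\<sigma> p < \<sigma> l" "\<sigma> l < \<sigma> j" "\<sigma> j < \<sigma> i"
      unfolding has_4321_def by auto
    thus ?L unfolding has_4321_def
      by (intro exI[of _ i] exI[of _ j] exI[of _ l] exI[of _ p]) (auto simp: direct_sum_def)
  next
    assume "has_4321 m \<tau>"
    then obtain i j l p where "1 \<le> i" "i < j" "j < l" "l < p" "p \<le> m" "\<tau> p < \<tau> l" "\<tau> l < \<tau> j" "\<tau> j < \<tau> i"
      unfolding has_4321_def by auto
    thus ?L unfolding has_4321_def
      by (intro exI[of _ "k + i"] exI[of _ "k + j"] exI[of _ "k + l"] exI[of _ "k + p"])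
        (auto simp: direct_sum_def)
  qed
qed

text \<open>
  An inversion in the second summand extends to a 132 by any entry of the first, and a permutation
  without inversions is the identity.
\<close>

lemma has_132_direct_sum:
  assumes k: "k \<ge> 1"
  shows "has_132 (k + m) (direct_sum k \<sigma> \<tau>) \<longleftrightarrow> has_132 k \<sigma> \<or> \<tau> \<noteq> id" (is "?L \<longleftrightarrow> ?R")
proof
  assume ?L
  then obtain i j l where h: "1 \<le> i" "i < j" "j < l" "l \<le> k + m"
    "direct_sum k \<sigma> \<tau> i < direct_sum k \<sigma> \<tau> l" "direct_sum k \<sigma> \<tau> l < direct_sum k \<sigma> \<tau> j"
    unfolding has_132_def by auto
  show ?R
  proof (cases "l \<le> k")
    case True
    hence "has_132 k \<sigma>" using h unfolding has_132_def
      by (intro exI[of _ i] exI[of _ j] exI[of _ l]) (auto simp: direct_sum_def)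
    thus ?thesis ..
  next
    case False
    hence "\<not> j \<le> k" using h direct_sum_le_iff[of j] direct_sum_le_iff[of l] by linarith
    hence "\<tau> (l - k) < \<tau> (j - k)" using False h by (auto simp: direct_sum_def)
    hence "\<tau> \<noteq> id" using h by auto
    thus ?thesis ..
  qed
next
  assume ?R
  thus ?L
  proof
    assume "has_132 k \<sigma>"
    then obtain i j l where "1 \<le> i" "i < j" "j < l" "l \<le> k" "\<sigma> i < \<sigma> l" "\<sigma> l < \<sigma> j"
      unfolding has_132_def by auto
    thus ?L unfolding has_132_def
      by (intro exI[of _ i] exI[of _ j] exI[of _ l]) (auto simp: direct_sum_def)
  next
    assume ne: "\<tau> \<noteq> id"
    have "\<exists>j l. 1 \<le> j \<and> j < l \<and> l \<le> m \<and> \<tau> l < \<tau> j"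
    proof -
      \<comment> \<open>At the first moved position the entry is too large; the right entry comes later.\<close>
      define j where "j = (LEAST i. \<tau> i \<noteq> i)"
      have j: "\<tau> j \<noteq> j" unfolding j_def by (rule LeastI_ex) (use ne in fastforce)
      have below: "\<tau> i = i" if "i < j" for i using not_less_Least that unfolding j_def by blast
      obtain l where l: "\<tau> l = j" using permutes_surj[OF \<tau>] by (metis surj_def)
      have "\<not> l < j" using below[of l] l by auto
      moreover have "l \<noteq> j" using l j by auto
      moreover have "\<not> \<tau> j < j" using below[of "\<tau> j"] j permutes_inj[OF \<tau>] by (metis inj_eq)
      moreover have "1 \<le> j" "l \<le> m"
        using j permutes_not_in[OF \<tau>, of j] permutes_not_in[OF \<tau>, of l] l \<open>l \<noteq> j\<close> by auto
      ultimately show ?thesis using l j by (intro exI[of _ j] exI[of _ l]) auto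
    qed
    then obtain j l where h: "1 \<le> j" "j < l" "l \<le> m" "\<tau> l < \<tau> j" by auto
    have "\<sigma> k \<le> k" "1 \<le> \<tau> l" using permutes_atLeast1_bounds[OF \<sigma>, of k] 
        permutes_atLeast1_bounds[OF \<tau>, of l] h by auto
    thus ?L using h k unfolding has_132_def
      by (intro exI[of _ k] exI[of _ "k + j"] exI[of _ "k + l"]) (auto simp: direct_sum_def)
  qed
qed

end


definition avoiders :: "nat \<Rightarrow> (nat \<Rightarrow> nat) set" where
  "avoiders n = {\<pi>. \<pi> permutes {1..n} \<and> \<not> has_312 n \<pi> \<and> \<not> has_4321 n \<pi>}"

text \<open>
  For \<open>k = 0\<close> there is no such block, since a permutation of the empty set fixes 0.
\<close>

definition leading_blocks :: "nat \<Rightarrow> (nat \<Rightarrow> nat) set" where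
  "leading_blocks k = {\<sigma> \<in> avoiders k. \<sigma> k = 1}"

lemma finite_avoiders: "finite (avoiders n)"
  unfolding avoiders_def by (rule finite_subset[OF _ finite_permutations[of "{1..n}"]]) auto

lemma finite_leading_blocks: "finite (leading_blocks k)"
  unfolding leading_blocks_def using finite_avoiders by simp

text \<open>
  The block ends at the position \<open>k\<close> of the entry 1: an entry before it that exceeded an entry after
  it would complete a 312. Hence the entries from position \<open>k + 1\<close> on all exceed \<open>\<pi> i\<close> for every
  \<open>i \<le> k\<close>; there are \<open>n - k\<close> of them but only \<open>n - \<pi> i\<close> larger values, so \<open>\<pi> i \<le> k\<close>.
\<close>

lemma avoider_splits:
  assumes \<pi>: "\<pi> \<in> avoiders n" and n: "n \<ge> 1"
  shows "\<exists>k\<in>{1..n}. \<exists>\<sigma>\<in>leading_blocks k. \<exists>\<tau>\<in>avoiders (n - k). \<pi> = direct_sum k \<sigma> \<tau>"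
proof -
  have perm: "\<pi> permutes {1..n}" and no312: "\<not> has_312 n \<pi>" and no4321: "\<not> has_4321 n \<pi>"
    using \<pi> by (auto simp: avoiders_def)
  note bounds = permutes_atLeast1_bounds[OF perm]
  have inj: "\<pi> x = \<pi> y \<longleftrightarrow> x = y" for x y using permutes_inj[OF perm] by (auto simp: inj_def)
  obtain k where \<pi>k: "\<pi> k = 1" using permutes_surj[OF perm] by (metis surj_def)
  have k: "1 \<le> k" "k \<le> n" using bounds[of k] \<pi>k n by auto
  have cross: "\<pi> i < \<pi> l" if "1 \<le> i" "i \<le> k" "k < l" "l \<le> n" for i l
  proof (cases "i = k")
    case True
    have "\<pi> l \<noteq> \<pi> k" using that inj by simp
    thus ?thesis using bounds(2)[of l] that \<pi>k True by auto
  next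
    case False
    have "\<pi> k < \<pi> l" using bounds(2)[of l] that \<pi>k inj[of l k] by auto
    moreover have "\<pi> i \<noteq> \<pi> l" using that inj by simp
    ultimately show ?thesis
      using no312 that False unfolding has_312_def by (metis le_neq_implies_less linorder_neqE_nat)
  qed
  have low: "\<pi> i \<le> k" if "i \<le> k" for i
  proof (cases "i = 0")
    case True
    thus ?thesis using bounds(2)[of 0] by simp
  next
    case False
    have "\<pi> ` {k + 1..n} \<subseteq> {\<pi> i + 1..n}"
      using cross[of i] bounds(1) that False by (auto simp: Suc_le_eq)
    hence "card (\<pi> ` {k + 1..n}) \<le> card {\<pi> i + 1..n}" by (intro card_mono) auto
    moreover have "card (\<pi> ` {k + 1..n}) = card {k + 1..n}"
      by (intro card_image) (auto simp: inj_on_def inj)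
    ultimately show ?thesis using bounds(1)[of i] that k by auto
  qed
  define \<sigma> where "\<sigma> i = (if i \<le> k then \<pi> i else i)" for i
  have \<sigma>: "\<sigma> permutes {1..k}"
  proof (rule permutesI_inj_on)
    show "\<sigma> x \<in> {1..k}" if "x \<in> {1..k}" for x
      using that low[of x] bounds(2)[of x] by (auto simp: \<sigma>_def)
    show "\<sigma> x = x" if "x \<notin> {1..k}" for x
      using that bounds(2)[of 0] by (cases "x = 0") (auto simp: \<sigma>_def)
  qed (auto simp: \<sigma>_def inj_on_def inj)
  have high: "k < \<pi> i" if i: "k < i" for i
  proof (rule ccontr)
    assume "\<not> k < \<pi> i"
    then obtain x where "\<sigma> x = \<pi> i" using permutes_surj[OF \<sigma>] by (metis surj_def)
    moreover have "x \<le> k" using permutes_atLeast1_bounds(1)[OF \<sigma>, of x] calculation \<open>\<not> k < \<pi> i\<close> by simp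
    ultimately show False using inj i by (auto simp: \<sigma>_def)
  qed
  define \<tau> where "\<tau> i = \<pi> (i + k) - k" for i
  have \<tau>: "\<tau> permutes {1..n - k}"
  proof (rule permutesI_inj_on)
    show "\<tau> x \<in> {1..n - k}" if "x \<in> {1..n - k}" for x
      using that high[of "x + k"] bounds(1)[of "x + k"] k by (auto simp: \<tau>_def)
    show "\<tau> x = x" if "x \<notin> {1..n - k}" for x
    proof (cases "x = 0")
      case True
      thus ?thesis using \<pi>k k by (simp add: \<tau>_def)
    next
      case False
      hence "x + k \<notin> {1..n}" using that by auto
      thus ?thesis using permutes_not_in[OF perm] by (simp add: \<tau>_def)
    qed
    show "inj_on \<tau> {1..n - k}"
    proof (rule inj_onI)
      fix x y assume "x \<in> {1..n - k}" "y \<in> {1..n - k}" "\<tau> x = \<tau> y"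
      hence "\<pi> (x + k) = \<pi> (y + k)" using high[of "x + k"] high[of "y + k"] by (auto simp: \<tau>_def)
      thus "x = y" by (simp add: inj)
    qed
  qed auto
  have eq: "\<pi> = direct_sum k \<sigma> \<tau>"
  proof
    fix i show "\<pi> i = direct_sum k \<sigma> \<tau> i"
      using high[of i] by (cases "i \<le> k") (auto simp: direct_sum_def \<sigma>_def \<tau>_def)
  qed
  have "\<sigma> k = 1" using \<pi>k by (simp add: \<sigma>_def)
  hence "\<sigma> \<in> leading_blocks k" "\<tau> \<in> avoiders (n - k)"
    using no312 no4321 \<sigma> \<tau> has_312_direct_sum[OF \<sigma> \<tau>] has_4321_direct_sum[OF \<sigma> \<tau>] k
    unfolding leading_blocks_def avoiders_def eq by auto
  moreover have "k \<in> {1..n}" using k by simp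
  ultimately show ?thesis using eq by blast
qed

text \<open>
  Uniqueness of the splitting: the length of the block can be recovered as the position of the
  entry 1.
\<close>

lemma direct_sum_leading_block_inj:
  assumes "\<sigma> permutes {1..k}" "\<sigma> k = 1" "\<tau> permutes {1..m}"
    and "\<sigma>' permutes {1..k'}" "\<sigma>' k' = 1" "\<tau>' permutes {1..m'}"
    and eq: "direct_sum k \<sigma> \<tau> = direct_sum k' \<sigma>' \<tau>'"
  shows "k = k' \<and> \<sigma> = \<sigma>' \<and> \<tau> = \<tau>'"
proof -
  have "direct_sum k' \<sigma>' \<tau>' k = direct_sum k' \<sigma>' \<tau>' k'"
    using assms by (metis direct_sum_def order_refl)
  hence k: "k = k'" using permutes_inj[OF direct_sum_permutes] assms(4,6) by (metis injD)
  have "\<sigma> i = \<sigma>' i" for i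
    using fun_cong[OF eq, of i] k permutes_not_in[OF assms(1), of i] permutes_not_in[OF assms(4), of i]
    by (cases "i \<le> k") (auto simp: direct_sum_def)
  moreover have "\<tau> i = \<tau>' i" for i
    using fun_cong[OF eq, of "k + i"] k
      permutes_atLeast1_bounds(2)[OF assms(3), of i] permutes_atLeast1_bounds(2)[OF assms(6), of i]
    by (cases "i = 0") (auto simp: direct_sum_def)
  ultimately show ?thesis using k by auto
qed

text \<open>
  Used twice: with \<open>Q\<close> saying that \<open>\<pi>\<^sup>2\<close> is the identity, and with \<open>Q\<close> saying that \<open>\<pi>\<^sup>2\<close>
  avoids 132. In both cases \<open>Q\<close> splits into independent conditions on the two summands.
\<close>

lemma card_avoiders_by_leading_block:
  assumes n: "n \<ge> 1"
    and Q: "\<And>k \<sigma> \<tau>. 1 \<le> k \<Longrightarrow> k \<le> n \<Longrightarrow> \<sigma> \<in> leading_blocks k \<Longrightarrow> \<tau> \<in> avoiders (n - k) \<Longrightarrow>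
              Q (direct_sum k \<sigma> \<tau>) \<longleftrightarrow> B k \<sigma> \<and> R \<tau>"
  shows "card {\<pi> \<in> avoiders n. Q \<pi>} =
    (\<Sum>k=1..n. card {\<sigma> \<in> leading_blocks k. B k \<sigma>} * card {\<tau> \<in> avoiders (n - k). R \<tau>})"
proof -
  let ?B = "\<lambda>k. {\<sigma> \<in> leading_blocks k. B k \<sigma>}" and ?R = "\<lambda>m. {\<tau> \<in> avoiders m. R \<tau>}"
  let ?D = "SIGMA k:{1..n}. ?B k \<times> ?R (n - k)"
  let ?f = "\<lambda>(k, \<sigma>, \<tau>). direct_sum k \<sigma> \<tau>"
  have "?f ` ?D = {\<pi> \<in> avoiders n. Q \<pi>}"
  proof (intro equalityI subsetI)
    fix \<pi> assume "\<pi> \<in> ?f ` ?D"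
    then obtain k \<sigma> \<tau> where h: "k \<in> {1..n}" "\<sigma> \<in> ?B k" "\<tau> \<in> ?R (n - k)" "\<pi> = direct_sum k \<sigma> \<tau>" by auto
    have p: "\<sigma> permutes {1..k}" "\<tau> permutes {1..n - k}"
      using h by (auto simp: leading_blocks_def avoiders_def)
    have "k + (n - k) = n" using h by auto
    hence "\<pi> \<in> avoiders n"
      using direct_sum_permutes[OF p] has_312_direct_sum[OF p] has_4321_direct_sum[OF p] h
      by (auto simp: leading_blocks_def avoiders_def)
    thus "\<pi> \<in> {\<pi> \<in> avoiders n. Q \<pi>}" using h Q by auto
  next
    fix \<pi> assume \<pi>: "\<pi> \<in> {\<pi> \<in> avoiders n. Q \<pi>}"
    then obtain k \<sigma> \<tau> where h: "k \<in> {1..n}" "\<sigma> \<in> leading_blocks k" "\<tau> \<in> avoiders (n - k)"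
      "\<pi> = direct_sum k \<sigma> \<tau>"
      using avoider_splits[OF _ n] by blast
    hence "(k, \<sigma>, \<tau>) \<in> ?D" using \<pi> Q by auto
    thus "\<pi> \<in> ?f ` ?D" using h(4) by force
  qed
  moreover have "inj_on ?f ?D"
  proof (rule inj_onI)
    fix x y assume h: "x \<in> ?D" "y \<in> ?D" "?f x = ?f y"
    obtain k \<sigma> \<tau> k' \<sigma>' \<tau>' where "x = (k, \<sigma>, \<tau>)" "y = (k', \<sigma>', \<tau>')" by (metis prod_cases3)
    thus "x = y" using h direct_sum_leading_block_inj[of \<sigma> k \<tau> "n - k" \<sigma>' k' \<tau>' "n - k'"]
      by (auto simp: leading_blocks_def avoiders_def)
  qed
  ultimately have "card {\<pi> \<in> avoiders n. Q \<pi>} = card ?D" using card_image[of ?f ?D] by argo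
  also have "\<dots> = (\<Sum>k=1..n. card (?B k \<times> ?R (n - k)))"
    using finite_avoiders finite_leading_blocks by (intro card_SigmaI) auto
  finally show ?thesis by (simp add: card_cartesian_product)
qed

section \<open>Counting the involutions\<close>

definition reverse_block :: "nat \<Rightarrow> nat \<Rightarrow> nat" where
  "reverse_block k i = (if 1 \<le> i \<and> i \<le> k then k + 1 - i else i)"

lemma reverse_block_in:
  assumes "1 \<le> k" "k \<le> 3"
  shows "reverse_block k \<in> leading_blocks k" and "reverse_block k \<circ> reverse_block k = id"
proof -
  have "reverse_block k permutes {1..k}"
    by (rule permutesI_inj_on) (auto simp: reverse_block_def inj_on_def)
  moreover have "\<not> has_312 k (reverse_block k)"
    by (auto simp: has_312_def reverse_block_def)
  moreover have "\<not> has_4321 k (reverse_block k)"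
    using assms by (auto simp: has_4321_def)
  ultimately show "reverse_block k \<in> leading_blocks k"
    using assms by (auto simp: leading_blocks_def avoiders_def reverse_block_def)
  show "reverse_block k \<circ> reverse_block k = id" by (auto simp: reverse_block_def fun_eq_iff)
qed

text \<open>
  Since \<open>\<sigma> k = 1\<close>, also \<open>\<sigma> 1 = k\<close>. An ascent after this first, largest entry would give 312, so
  \<open>\<sigma>\<close> is decreasing, and avoiding 4321 bounds its length.
\<close>

lemma involutive_leading_block:
  assumes \<sigma>: "\<sigma> \<in> leading_blocks k" and inv: "\<sigma> \<circ> \<sigma> = id"
  shows "1 \<le> k \<and> k \<le> 3 \<and> \<sigma> = reverse_block k"
proof -
  have perm: "\<sigma> permutes {1..k}" and \<sigma>k: "\<sigma> k = 1"
    and no: "\<not> has_312 k \<sigma>" "\<not> has_4321 k \<sigma>"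
    using \<sigma> by (auto simp: leading_blocks_def avoiders_def)
  note bounds = permutes_atLeast1_bounds[OF perm]
  have inj: "\<sigma> x = \<sigma> y \<longleftrightarrow> x = y" for x y using permutes_inj[OF perm] by (auto simp: inj_def)
  have \<sigma>1: "\<sigma> 1 = k" using fun_cong[OF inv, of k] \<sigma>k by simp
  have k1: "1 \<le> k" using bounds(2)[of k] \<sigma>k by auto
  have decr: "\<sigma> j < \<sigma> i" if "1 \<le> i" "i < j" "j \<le> k" for i j
  proof (cases "i = 1")
    case True
    thus ?thesis using bounds(1)[of j] inj[of j i] \<sigma>1 that by auto
  next
    case False
    have "\<sigma> j < \<sigma> 1" using bounds(1)[of j] inj[of j 1] \<sigma>1 that by auto
    hence "\<not> \<sigma> i < \<sigma> j" using no(1) that False unfolding has_312_def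
      by (metis One_nat_def le_neq_implies_less le_refl)
    thus ?thesis using inj[of i j] that by auto
  qed
  have k3: "k \<le> 3"
  proof (rule ccontr)
    assume "\<not> k \<le> 3"
    hence "has_4321 k \<sigma>" unfolding has_4321_def
      using decr[of 1 2] decr[of 2 3] decr[of 3 4]
      by (intro exI[of _ 1] exI[of _ 2] exI[of _ 3] exI[of _ 4] conjI) auto
    thus False using no by simp
  qed
  have "\<sigma> i = reverse_block k i" for i
  proof (cases "i \<in> {1..k}")
    case False
    thus ?thesis using permutes_not_in[OF perm] by (auto simp: reverse_block_def)
  next
    case True
    have "\<sigma> 2 = 2" if "k = 3"
      using bounds[of 2] inj[of 2 1] inj[of 2 3] \<sigma>1 \<sigma>k that by (simp add: eval_nat_numeral)
    thus ?thesis using True k1 k3 \<sigma>1 \<sigma>k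
      by (cases "i = 1"; cases "i = k"; cases "i = 2") (auto simp: reverse_block_def)
  qed
  thus ?thesis using k1 k3 by auto
qed

lemma card_involutive_leading_blocks:
  "card {\<sigma> \<in> leading_blocks k. \<sigma> \<circ> \<sigma> = id} = (if k \<in> {1..3} then 1 else 0)"
proof (cases "k \<in> {1..3}")
  case True
  hence "{\<sigma> \<in> leading_blocks k. \<sigma> \<circ> \<sigma> = id} = {reverse_block k}"
    using involutive_leading_block reverse_block_in by fastforce
  thus ?thesis using True by simp
next
  case False
  hence "{\<sigma> \<in> leading_blocks k. \<sigma> \<circ> \<sigma> = id} = {}"
    using involutive_leading_block by fastforce
  thus ?thesis using False by (simp only: card.empty if_False)
qed

lemma direct_sum_eq_id_iff:
  assumes "\<sigma> permutes {1..k}" "\<tau> permutes {1..m}"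
  shows "direct_sum k \<sigma> \<tau> = id \<longleftrightarrow> \<sigma> = id \<and> \<tau> = id"
proof
  assume eq: "direct_sum k \<sigma> \<tau> = id"
  have "\<sigma> i = i" for i
    using fun_cong[OF eq, of i] permutes_not_in[OF assms(1), of i]
    by (cases "i \<le> k") (auto simp: direct_sum_def)
  moreover have "\<tau> i = i" for i
    using fun_cong[OF eq, of "k + i"] permutes_not_in[OF assms(2), of i]
    by (cases "i = 0") (auto simp: direct_sum_def)
  ultimately show "\<sigma> = id \<and> \<tau> = id" by auto
qed (auto simp: direct_sum_def fun_eq_iff)

text \<open>
  The first summand is one of the three decreasing blocks of lengths 1, 2 and 3, which is the
  Tribonacci recurrence; for \<open>m \<le> 2\<close> the lengths exceeding \<open>m\<close> drop out.
\<close>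

lemma card_involutive_avoiders:
  "card {\<tau> \<in> avoiders m. \<tau> \<circ> \<tau> = id} = tribonacci (m + 2)"
proof (induction m rule: less_induct)
  case (less m)
  show ?case
  proof (cases "m = 0")
    case True
    have "{\<tau> \<in> avoiders 0. \<tau> \<circ> \<tau> = id} = {id}"
      by (auto simp: avoiders_def has_312_def has_4321_def)
    thus ?thesis unfolding True by (simp only: card.insert) (simp add: numeral_2_eq_2)
  next
    case False
    have "card {\<tau> \<in> avoiders m. \<tau> \<circ> \<tau> = id} =
      (\<Sum>k=1..m. card {\<sigma> \<in> leading_blocks k. \<sigma> \<circ> \<sigma> = id} * card {\<tau> \<in> avoiders (m - k). \<tau> \<circ> \<tau> = id})"
    proof (rule card_avoiders_by_leading_block)
      fix k \<sigma> \<tau> assume "\<sigma> \<in> leading_blocks k" "\<tau> \<in> avoiders (m - k)"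
      hence p: "\<sigma> permutes {1..k}" "\<tau> permutes {1..m - k}" by (auto simp: leading_blocks_def avoiders_def)
      show "direct_sum k \<sigma> \<tau> \<circ> direct_sum k \<sigma> \<tau> = id \<longleftrightarrow> \<sigma> \<circ> \<sigma> = id \<and> \<tau> \<circ> \<tau> = id"
        unfolding direct_sum_square[OF p]
        by (intro direct_sum_eq_id_iff[of _ k _ "m - k"] permutes_compose p)
    qed (use False in simp)
    also have "\<dots> = (\<Sum>k=1..m. if k \<in> {1..3} then tribonacci (m - k + 2) else 0)"
      by (intro sum.cong) (auto simp: card_involutive_leading_blocks less.IH)
    also have "\<dots> = (\<Sum>k\<in>{1..m} \<inter> {1..3}. tribonacci (m - k + 2))"
      by (simp only: sum.inter_restrict finite_atLeastAtMost)
    also have "\<dots> = tribonacci (m + 2)"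
    proof -
      consider "m = 1" | "m = 2" | p where "m = Suc (Suc (Suc p))"
        using False by (metis One_nat_def not0_implies_Suc numeral_2_eq_2)
      thus ?thesis
      proof cases
        case 1
        hence "{1..m} \<inter> {1..3} = {1}" by auto
        thus ?thesis using 1 by (simp add: eval_nat_numeral)
      next
        case 2
        hence "{1..m} \<inter> {1..3} = {1, 2}" by auto
        thus ?thesis using 2 by (simp add: eval_nat_numeral)
      next
        case (3 p)
        hence "{1..m} \<inter> {1..3} = {1, 2, 3}" by auto
        thus ?thesis using 3 by (simp add: eval_nat_numeral)
      qed
    qed
    finally show ?thesis .
  qed
qed

section \<open>Leading blocks whose square avoids 132\<close>

definition cyclic_block :: "nat \<Rightarrow> nat \<Rightarrow> nat" where
  "cyclic_block k i = (if 1 \<le> i \<and> i < k then i + 1 else if i = k then 1 else i)"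

text \<open>
  In one-line form: 321 for \<open>k = 3\<close>, 3241 for \<open>k = 4\<close>, and \<open>2 4 3 5 \<dots> k 1\<close> for \<open>k \<ge> 5\<close>. In each
  case it is the cyclic block with the entries at positions \<open>s\<close> and \<open>s + 1\<close> exchanged.
\<close>

definition twisted_block :: "nat \<Rightarrow> nat \<Rightarrow> nat" where
  "twisted_block k i =
     (let s = (if k \<le> 4 then 1 else 2)
      in if i = s then s + 2 else if i = s + 1 then s + 1 else cyclic_block k i)"

lemma cyclic_block_in:
  assumes k: "1 \<le> k"
  shows "cyclic_block k \<in> leading_blocks k" and "\<not> has_132 k (cyclic_block k \<circ> cyclic_block k)"
proof -
  have "cyclic_block k permutes {1..k}"
    by (rule permutesI_inj_on) (use k in \<open>auto simp: cyclic_block_def inj_on_def split: if_splits\<close>)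
  moreover have "\<not> has_312 k (cyclic_block k)"
    by (auto simp: has_312_def cyclic_block_def split: if_splits)
  moreover have "\<not> has_4321 k (cyclic_block k)"
    by (auto simp: has_4321_def cyclic_block_def split: if_splits)
  ultimately show "cyclic_block k \<in> leading_blocks k"
    by (auto simp: leading_blocks_def avoiders_def cyclic_block_def)
  show "\<not> has_132 k (cyclic_block k \<circ> cyclic_block k)"
    by (auto simp: has_132_def cyclic_block_def split: if_splits)
qed

text \<open>
  The only inversions are those with the final entry 1 and the exchanged adjacent pair. A 312 needs
  an inversion with a position in between, and a 4321 two consecutive inversions before its last
  entry; the list of inversions allows neither.
\<close>

lemma twisted_block_inversion:
  assumes "3 \<le> k" "1 \<le> i" "i < j" "j \<le> k" "twisted_block k j < twisted_block k i"
  shows "j = k \<or> j = Suc i \<and> i = (if k \<le> 4 then 1 else 2)"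
proof (cases "k \<le> 4")
  case True
  thus ?thesis using assms by (auto simp: twisted_block_def cyclic_block_def split: if_splits)
next
  case False
  thus ?thesis using assms by (auto simp: twisted_block_def cyclic_block_def split: if_splits)
qed

text \<open>
  In one-line form the square is \<open>4 5 3 6 7 \<dots> k 1 2\<close>.
\<close>

lemma twisted_block_square:
  assumes "5 \<le> k" "1 \<le> i" "i \<le> k"
  shows "twisted_block k (twisted_block k i) =
    (if i = 1 then 4 else if i = 2 then 5 else if i = 3 then 3
     else if i = k - 1 then 1 else if i = k then 2 else i + 2)"
proof -
  have *: "twisted_block k i = (if i = 2 then 4 else if i = 3 then 3 else cyclic_block k i)" for i
    using assms(1) by (simp add: twisted_block_def)
  consider "i = 1" | "i = 2" | "i = 3" | "4 \<le> i" "i < k - 1" | "4 \<le> i" "i = k - 1" | "i = k"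
    using assms by linarith
  thus ?thesis using assms(1) by cases (auto simp: * cyclic_block_def)
qed

lemma twisted_block_in:
  assumes k: "3 \<le> k"
  shows "twisted_block k \<in> leading_blocks k" and "\<not> has_132 k (twisted_block k \<circ> twisted_block k)"
proof -
  have last: "twisted_block k k = 1"
    using k by (auto simp: twisted_block_def cyclic_block_def)
  have range: "twisted_block k i \<in> {1..k}" if "1 \<le> i" "i \<le> k" for i
    using that k by (auto simp: twisted_block_def cyclic_block_def)
  have "twisted_block k permutes {1..k}"
  proof (cases "k \<le> 4")
    case True
    thus ?thesis using k
      by (intro permutesI_inj_on) (auto simp: twisted_block_def cyclic_block_def inj_on_def split: if_splits)
  next
    case False
    thus ?thesis
      by (intro permutesI_inj_on) (auto simp: twisted_block_def cyclic_block_def inj_on_def split: if_splits)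
  qed
  moreover have "\<not> has_312 k (twisted_block k)"
  proof
    assume "has_312 k (twisted_block k)"
    then obtain i j l where h: "1 \<le> i" "i < j" "j < l" "l \<le> k"
      "twisted_block k j < twisted_block k l" "twisted_block k l < twisted_block k i"
      unfolding has_312_def by auto
    hence "l = k" using twisted_block_inversion[OF k, of i l] by auto
    thus False using h last range[of j] by auto
  qed
  moreover have "\<not> has_4321 k (twisted_block k)"
  proof
    assume "has_4321 k (twisted_block k)"
    then obtain i j l m where h: "1 \<le> i" "i < j" "j < l" "l < m" "m \<le> k"
      "twisted_block k l < twisted_block k j" "twisted_block k j < twisted_block k i"
      unfolding has_4321_def by auto
    thus False
      using twisted_block_inversion[OF k, of i j] twisted_block_inversion[OF k, of j l] by auto
  qed
  ultimately show "twisted_block k \<in> leading_blocks k"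
    using last by (auto simp: leading_blocks_def avoiders_def)
  show "\<not> has_132 k (twisted_block k \<circ> twisted_block k)"
  proof
    assume "has_132 k (twisted_block k \<circ> twisted_block k)"
    then obtain i j l where h: "1 \<le> i" "i < j" "j < l" "l \<le> k"
      "twisted_block k (twisted_block k i) < twisted_block k (twisted_block k l)"
      "twisted_block k (twisted_block k l) < twisted_block k (twisted_block k j)"
      unfolding has_132_def by auto
    consider "k = 3" | "k = 4" | "5 \<le> k" using k by linarith
    thus False
    proof cases
      case 1
      hence "i = 1" "j = 2" "l = 3" using h by auto
      thus False using 1 h by (simp add: twisted_block_def cyclic_block_def)
    next
      case 2
      hence "i = 1 \<or> i = 2" "j = 2 \<or> j = 3" "l = 3 \<or> l = 4" using h by auto
      thus False using 2 h by (auto simp: twisted_block_def cyclic_block_def)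
    next
      case 3
      have "1 \<le> j" "1 \<le> l" "i \<le> k" "j \<le> k" using h by auto
      hence "l \<in> {3, k - 1, k}"
        using h(3,6) twisted_block_square[OF 3, of j] twisted_block_square[OF 3, of l] h(4)
        by (auto split: if_splits)
      thus False using h \<open>1 \<le> j\<close> \<open>1 \<le> l\<close> \<open>i \<le> k\<close> 3 twisted_block_square[OF 3, of i]
          twisted_block_square[OF 3, of l] by (auto split: if_splits)
    qed
  qed
qed

lemma cyclic_block_neq_twisted_block:
  assumes "3 \<le> k"
  shows "cyclic_block k \<noteq> twisted_block k"
proof -
  let ?s = "if k \<le> 4 then 1 else 2"
  have "cyclic_block k ?s \<noteq> twisted_block k ?s"
    using assms by (auto simp: twisted_block_def cyclic_block_def)
  thus ?thesis by metis
qed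


text \<open>
  In this context \<open>\<sigma>\<close> is any admissible block of length at least 3; it will turn out to be one of
  the two blocks above.
\<close>

context
  fixes k :: nat and \<sigma> :: "nat \<Rightarrow> nat"
  assumes k: "3 \<le> k" and block: "\<sigma> \<in> leading_blocks k" and sq: "\<not> has_132 k (\<sigma> \<circ> \<sigma>)"
begin

lemma block_permutes: "\<sigma> permutes {1..k}"
  using block by (auto simp: leading_blocks_def avoiders_def)

lemma block_last: "\<sigma> k = 1"
  using block by (auto simp: leading_blocks_def)

lemma block_inj: "\<sigma> x = \<sigma> y \<longleftrightarrow> x = y"
  using permutes_inj[OF block_permutes] by (auto simp: inj_def)

lemmas block_bounds = permutes_atLeast1_bounds[OF block_permutes]

lemma block_preimage:
  assumes "1 \<le> a" "a \<le> k"
  obtains x where "\<sigma> x = a" "1 \<le> x" "x \<le> k"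
  using permutes_surj[OF block_permutes] block_bounds assms by (metis surj_def)

lemma square_no_132:
  assumes "1 \<le> i" "i < p" "p < q" "q \<le> k" "\<sigma> (\<sigma> i) < \<sigma> (\<sigma> q)"
  shows "\<sigma> (\<sigma> p) < \<sigma> (\<sigma> q)"
proof -
  have "\<not> \<sigma> (\<sigma> q) < \<sigma> (\<sigma> p)" using sq assms unfolding has_132_def by auto
  moreover have "\<sigma> (\<sigma> q) \<noteq> \<sigma> (\<sigma> p)" using block_inj assms by auto
  ultimately show ?thesis by simp
qed

text \<open>
  Two smaller entries after \<open>\<sigma> i\<close> form a 312 with it if they increase, and a 4321 together with
  the final 1 if they decrease.
\<close>

lemma no_two_smaller_after:
  assumes "1 \<le> i" "i < j" "i < l" "j \<noteq> l" "j < k" "l < k"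
  shows "\<sigma> i < \<sigma> j \<or> \<sigma> i < \<sigma> l"
proof -
  have no: "\<not> has_312 k \<sigma>" "\<not> has_4321 k \<sigma>"
    using block by (auto simp: leading_blocks_def avoiders_def)
  have *: "\<sigma> i < \<sigma> j \<or> \<sigma> i < \<sigma> l" if h: "i < j" "j < l" "l < k" for j l
  proof (rule ccontr)
    assume "\<not> ?thesis"
    hence lt: "\<sigma> j < \<sigma> i" "\<sigma> l < \<sigma> i" using block_inj[of i j] block_inj[of i l] h by auto
    have "\<not> \<sigma> j < \<sigma> l" using no(1) lt h assms(1) unfolding has_312_def by (metis less_imp_le)
    hence "\<sigma> l < \<sigma> j" using block_inj[of j l] h by auto
    moreover have "\<sigma> k < \<sigma> l"
      using block_last block_bounds(2)[of l] block_inj[of l k] h by auto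
    ultimately have "has_4321 k \<sigma>"
      using lt h assms(1) unfolding has_4321_def by (metis order_refl)
    thus False using no by simp
  qed
  show ?thesis using *[of j l] *[of l j] assms by linarith
qed

text \<open>
  A convenient form for forcing upper bounds: an entry cannot exceed two values, other than 1, that
  have not yet been used before it.
\<close>

lemma small_values_after:
  assumes "1 \<le> i" "i \<le> k" "2 \<le> a" "a < b" "b < \<sigma> i"
  shows "\<exists>x<i. \<sigma> x \<in> {a, b}"
proof (rule ccontr)
  assume no: "\<not> ?thesis"
  have "\<sigma> i \<le> k" using block_bounds(1) assms by simp
  hence "1 \<le> a" "a \<le> k" "1 \<le> b" "b \<le> k" using assms by auto
  then obtain x y where x: "\<sigma> x = a" "1 \<le> x" "x \<le> k" and y: "\<sigma> y = b" "1 \<le> y" "y \<le> k"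
    using block_preimage[of a thesis] block_preimage[of b thesis] by blast
  have "x \<noteq> k" "y \<noteq> k" using x y block_last assms by auto
  moreover have "x \<noteq> y" "x \<noteq> i" "y \<noteq> i" using x y assms by auto
  moreover have "\<not> x < i" "\<not> y < i" using no x y by auto
  ultimately show False using no_two_smaller_after[of i x y] x y assms by auto
qed

lemma block_first: "\<sigma> 1 = 2 \<or> \<sigma> 1 = 3"
proof -
  have "\<sigma> 1 \<noteq> 1" using block_inj[of 1 k] block_last k by auto
  moreover have "\<sigma> 1 \<ge> 1" using block_bounds(2)[of 1] by simp
  moreover have "\<not> 3 < \<sigma> 1"
    using small_values_after[of 1 2 3] block_bounds(2)[of 0] k by (auto simp: less_Suc_eq)
  ultimately show ?thesis by linarith
qed

text \<open>
  The square \<open>S\<close> of the block ends in 3. Between the position of 1 or 2 in \<open>S\<close> and the end there is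
  no entry above 3, so 1 and 2 occupy the two places before the end, and the position \<open>q\<close> of 2
  is at least \<open>k - 2\<close>. Here \<open>\<sigma>\<close> maps \<open>q\<close> to the position \<open>p\<close> of its entry 2. If \<open>q < p\<close>, the
  positions \<open>p\<close> and that of the entry \<open>k\<close> would coincide; if \<open>p < q\<close>, the entries before position
  \<open>p\<close> would have too few values to choose from. So \<open>p = q\<close>, hence both are 2 and \<open>k \<le> 4\<close>.
\<close>

lemma block_first_3:
  assumes \<sigma>1: "\<sigma> 1 = 3"
  shows "\<sigma> = twisted_block k"
proof -
  define S where "S = \<sigma> \<circ> \<sigma>"
  have S_inj: "S x = S y \<longleftrightarrow> x = y" for x y by (simp add: S_def block_inj)
  have S_pos: "1 \<le> S x \<longleftrightarrow> 1 \<le> x" for x unfolding S_def o_def by (simp only: block_bounds(2))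
  have Sk: "S k = 3" using \<sigma>1 by (simp add: S_def block_last)
  obtain p where p: "\<sigma> p = 2" "1 \<le> p" "p \<le> k" using block_preimage[of 2] k by auto
  have pk: "p < k" "p \<noteq> 1" using p block_last \<sigma>1 by (auto simp: le_less)
  obtain q where q: "\<sigma> q = p" "1 \<le> q" "q \<le> k" using block_preimage[of p] p by auto
  obtain j where j: "\<sigma> j = k" "1 \<le> j" "j \<le> k" using block_preimage[of k] k by auto
  have Sq: "S q = 2" and Sj: "S j = 1" by (simp_all add: S_def p q j block_last)
  have only: "x = j \<or> x = q" if "y < x" "x < k" "y = j \<or> y = q" for x y
  proof (rule ccontr)
    assume "\<not> ?thesis"
    hence "S x \<noteq> S j" "S x \<noteq> S q" "S x \<noteq> S k" using that by (auto simp: S_inj)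
    moreover have "1 \<le> S x" using S_pos that by auto
    ultimately have "3 < S x" using Sq Sj Sk by linarith
    moreover have "S x < S k"
      using square_no_132[of y x k] that Sq Sj Sk j q by (auto simp: S_def)
    ultimately show False using Sk by simp
  qed
  have ne: "j \<noteq> q" "j \<noteq> k" "q \<noteq> k" using Sq Sj Sk by auto
  have jq: "{j, q} = {k - 2, k - 1}"
  proof (cases "j < q")
    case True
    have "\<not> q + 1 < k" using only[of q "q + 1"] True by auto
    hence "q + 1 = k" using q ne by linarith
    moreover have "j + 1 < k" using True \<open>q + 1 = k\<close> by linarith
    hence "j + 1 = q" using only[of j "j + 1"] by auto
    ultimately show ?thesis by auto
  next
    case False
    have "\<not> j + 1 < k" using only[of j "j + 1"] False by auto
    hence "j + 1 = k" using j ne by linarith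
    moreover have "q + 1 < k" using False ne \<open>j + 1 = k\<close> by linarith
    hence "q + 1 = j" using only[of q "q + 1"] by auto
    ultimately show ?thesis by auto
  qed
  have "p = q"
  proof (rule ccontr)
    assume "p \<noteq> q"
    show False
    proof (cases "q < p")
      case True
      hence "q = k - 2" "p = k - 1" using jq pk ne by (auto simp: doubleton_eq_iff)
      hence "j = p" using jq ne by (auto simp: doubleton_eq_iff)
      thus False using p j k by auto
    next
      case False
      hence pq: "p < q" using \<open>p \<noteq> q\<close> by simp
      \<comment> \<open>Entries before position \<open>p\<close> avoid 1, 2, \<open>p\<close>, and cannot exceed both later entries \<open>p\<close> and 2:
        there are too few values left.\<close>
      have "\<sigma> i \<in> {3..<p}" if "i \<in> {1..<p}" for i
      proof -
        have "\<sigma> i \<noteq> 1" "\<sigma> i \<noteq> 2" "\<sigma> i \<noteq> p"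
          using block_inj[of i k] block_inj[of i p] block_inj[of i q] block_last p q pk pq that by auto
        moreover have "1 \<le> \<sigma> i" using block_bounds(2) that by auto
        moreover have "\<not> p < \<sigma> i"
          using no_two_smaller_after[of i p q] that p q pk pq ne by auto
        ultimately show ?thesis by auto
      qed
      hence "card (\<sigma> ` {1..<p}) \<le> card {3..<p}" by (intro card_mono) auto
      moreover have "card (\<sigma> ` {1..<p}) = card {1..<p}"
        by (intro card_image) (auto simp: inj_on_def block_inj)
      ultimately show False using pk p by auto
    qed
  qed
  hence p2: "p = 2" using p q by simp
  hence "k = 3 \<or> k = 4" using jq \<open>p = q\<close> k by (auto simp: doubleton_eq_iff)
  show ?thesis
  proof
    fix i
    have "\<sigma> 3 = 4" if "k = 4"
      using jq ne j \<open>p = q\<close> p2 that by (auto simp: doubleton_eq_iff)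
    moreover have "i \<notin> {1..k} \<Longrightarrow> \<sigma> i = i" using permutes_not_in[OF block_permutes] by auto
    moreover have "i = 1 \<or> i = 2 \<or> i = 3 \<or> i = 4" if "i \<in> {1..k}"
      using that \<open>k = 3 \<or> k = 4\<close> by auto
    ultimately show "\<sigma> i = twisted_block k i"
      using \<open>k = 3 \<or> k = 4\<close> \<sigma>1 p p2 block_last
      by (auto simp: twisted_block_def cyclic_block_def)
  qed
qed

text \<open>
  The first entry of the square is \<open>\<sigma> 2\<close>, and its larger entries must increase. So a value \<open>w\<close>
  above \<open>\<sigma> 2\<close> cannot come after an entry of the square that exceeds it.
\<close>

lemma block_next_value:
  assumes "\<sigma> 1 = 2" "2 \<le> p" "p \<le> k" "\<sigma> 2 < w" "w < \<sigma> (\<sigma> p)"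
  shows "\<exists>q. 1 \<le> q \<and> q < p \<and> \<sigma> (\<sigma> q) = w"
proof -
  have "\<sigma> (\<sigma> p) \<le> k" using assms by (simp add: block_bounds(1))
  then obtain y where y: "\<sigma> y = w" "1 \<le> y" "y \<le> k" using block_preimage[of w] assms by auto
  obtain q where q: "\<sigma> q = y" "1 \<le> q" "q \<le> k" using block_preimage[of y] y by auto
  have "q \<noteq> p" using q y assms by auto
  moreover have "\<not> p < q" using square_no_132[of 1 p q] assms q y by auto
  ultimately show ?thesis using q y by (intro exI[of _ q]) auto
qed

text \<open>
  The square now ends in 2, so 1 must stand directly before it, which means \<open>\<sigma> (k - 1) = k\<close>. The
  second entry of \<open>\<sigma>\<close> is 3 or 4, and each choice determines all further entries: by
  \<open>block_next_value\<close> the entry \<open>\<sigma> i\<close>, which is also an entry of the square, cannot skip the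
  value \<open>i + 1\<close>, and by injectivity it cannot be smaller. In the case of 4 one first excludes
  \<open>\<sigma> 3 \<noteq> 3\<close>: then \<open>\<sigma> 3 = 5\<close>, and the value 5 would come too late in the square.
\<close>

lemma block_first_2:
  assumes \<sigma>1: "\<sigma> 1 = 2"
  shows "\<sigma> = cyclic_block k \<or> \<sigma> = twisted_block k"
proof -
  have pos: "1 \<le> \<sigma> x \<longleftrightarrow> 1 \<le> x" for x by (rule block_bounds(2))
  have outside: "\<sigma> i = i" if "i \<notin> {1..k}" for i using permutes_not_in[OF block_permutes that] .
  have fresh: "\<sigma> i \<noteq> a" if "\<sigma> x = a" "i \<noteq> x" for i x a using that block_inj[of i x] by simp
  have pen: "\<sigma> (k - 1) = k"
  proof -
    obtain j where j: "\<sigma> j = k" "1 \<le> j" "j \<le> k" using block_preimage[of k] k by auto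
    have "j \<noteq> k" using j block_last k by auto
    moreover have "\<not> j < k - 1"
    proof
      assume lt: "j < k - 1"
      have "\<sigma> (\<sigma> (k - 1)) < \<sigma> (\<sigma> k)"
        using square_no_132[of j "k - 1" k] j lt block_last \<sigma>1 by auto
      moreover have "\<sigma> (\<sigma> (k - 1)) \<noteq> \<sigma> (\<sigma> j)" using block_inj lt by auto
      moreover have "1 \<le> \<sigma> (\<sigma> (k - 1))" unfolding pos using k by simp
      ultimately show False using j block_last \<sigma>1 by simp
    qed
    ultimately have "j = k - 1" using j by linarith
    thus ?thesis using j by simp
  qed
  have \<sigma>2: "\<sigma> 2 = 3 \<or> \<sigma> 2 = 4"
  proof -
    have "\<sigma> 2 \<noteq> 1" "\<sigma> 2 \<noteq> 2" using fresh[OF block_last, of 2] fresh[OF \<sigma>1, of 2] k by auto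
    moreover have "1 \<le> \<sigma> 2" using pos by simp
    moreover have "\<not> 4 < \<sigma> 2"
    proof
      assume "4 < \<sigma> 2"
      then obtain x where "x < 2" "\<sigma> x \<in> {3, 4}" using small_values_after[of 2 3 4] k by auto
      thus False using \<sigma>1 pos[of 0] by (cases "x = 0") (auto simp: less_2_cases_iff)
    qed
    ultimately show ?thesis by linarith
  qed
  show ?thesis
  proof (cases "\<sigma> 2 = 3")
    case True
    have shift: "1 \<le> i \<Longrightarrow> i < k \<Longrightarrow> \<sigma> i = i + 1" for i
    proof (induction i rule: less_induct)
      case (less i)
      show ?case
      proof (cases "i \<le> 2")
        case le: True
        hence "i = 1 \<or> i = 2" using less.prems by linarith
        thus ?thesis using \<sigma>1 True by auto
      next
        case False
        have prev: "\<sigma> (i - 1) = i" using less.IH[of "i - 1"] less.prems False by auto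
        have "\<not> \<sigma> i \<le> i"
        proof
          assume le: "\<sigma> i \<le> i"
          have "\<sigma> i \<noteq> 1" using fresh[OF block_last, of i] less.prems by auto
          hence "\<sigma> (\<sigma> i - 1) = \<sigma> i"
            using less.IH[of "\<sigma> i - 1"] le pos[of i] less.prems by auto
          hence "\<sigma> i - 1 = i" by (simp only: block_inj)
          thus False using le less.prems by auto
        qed
        moreover have "\<not> i + 1 < \<sigma> i"
        proof
          assume gt: "i + 1 < \<sigma> i"
          have "\<exists>q. 1 \<le> q \<and> q < i - 1 \<and> \<sigma> (\<sigma> q) = i + 1"
            by (rule block_next_value[OF \<sigma>1]) (use gt prev False True less.prems in auto)
          then obtain q where q: "1 \<le> q" "q < i - 1" "\<sigma> (\<sigma> q) = i + 1" by blast
          have "\<sigma> q = q + 1" using less.IH[of q] q less.prems by auto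
          moreover have "\<sigma> (q + 1) = q + 2" using less.IH[of "q + 1"] q less.prems by auto
          ultimately show False using q by auto
        qed
        ultimately show ?thesis by linarith
      qed
    qed
    have "\<sigma> i = cyclic_block k i" for i
      using shift[of i] block_last outside[of i] by (auto simp: cyclic_block_def)
    thus ?thesis by auto
  next
    case False
    hence \<sigma>2: "\<sigma> 2 = 4" using \<sigma>2 by simp
    have "k \<noteq> 3" using block_bounds(1)[of 2] \<sigma>2 by auto
    moreover have "k \<noteq> 4" using pen fresh[OF \<sigma>2, of 3] by auto
    ultimately have k5: "5 \<le> k" using k by linarith
    have \<sigma>3: "\<sigma> 3 = 3"
    proof (rule ccontr)
      assume ne3: "\<sigma> 3 \<noteq> 3"
      have "\<sigma> 3 \<noteq> 1" "\<sigma> 3 \<noteq> 2" "\<sigma> 3 \<noteq> 4"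
        using fresh[OF block_last, of 3] fresh[OF \<sigma>1, of 3] fresh[OF \<sigma>2, of 3] k5 by auto
      moreover have "1 \<le> \<sigma> 3" using pos by simp
      moreover have "\<not> 5 < \<sigma> 3"
      proof
        assume "5 < \<sigma> 3"
        then obtain x where "x < 3" "\<sigma> x \<in> {3, 5}" using small_values_after[of 3 3 5] k5 by auto
        moreover from this have "x = 0 \<or> x = 1 \<or> x = 2" by auto
        ultimately show False using \<sigma>1 \<sigma>2 pos[of 0] by auto
      qed
      ultimately have \<sigma>3: "\<sigma> 3 = 5" using ne3 by linarith
      have k6: "6 \<le> k" using pen fresh[OF \<sigma>3, of 4] k5 by (cases "k = 5") auto
      show False
      proof (cases "\<sigma> 4 = 3")
        case True
        have "\<sigma> 5 \<notin> {1, 2, 3, 4, 5}"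
          using fresh[OF block_last, of 5] fresh[OF \<sigma>1, of 5] fresh[OF \<sigma>2, of 5] fresh[OF \<sigma>3, of 5]
            fresh[OF True, of 5] k6 by auto
        hence "5 < \<sigma> 5" using pos[of 5] by auto
        then obtain q where q: "1 \<le> q" "q < 3" "\<sigma> (\<sigma> q) = 5"
          using block_next_value[OF \<sigma>1, of 3 5] \<sigma>2 \<sigma>3 k5 by auto
        from q have "q = 1 \<or> q = 2" by linarith
        thus False using q \<sigma>1 \<sigma>2 True by auto
      next
        case False
        have "\<sigma> 4 \<notin> {1, 2, 3, 4, 5}"
          using fresh[OF block_last, of 4] fresh[OF \<sigma>1, of 4] fresh[OF \<sigma>2, of 4] fresh[OF \<sigma>3, of 4]
            False k6 by auto
        hence "5 < \<sigma> 4" using pos[of 4] by auto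
        then obtain q where q: "1 \<le> q" "q < 2" "\<sigma> (\<sigma> q) = 5"
          using block_next_value[OF \<sigma>1, of 2 5] \<sigma>2 k5 by auto
        from q have "q = 1" by linarith
        thus False using q(3) \<sigma>1 \<sigma>2 by simp
      qed
    qed
    have shift: "4 \<le> i \<Longrightarrow> i < k \<Longrightarrow> \<sigma> i = i + 1" for i
    proof (induction i rule: less_induct)
      case (less i)
      \<comment> \<open>The position that \<open>\<sigma>\<close> sends to \<open>i\<close>: the value 4 sits at position 2, not at 3.\<close>
      define p where "p = (if i = 4 then 2 else i - 1)"
      have prev: "\<sigma> p = i" using less.IH[of "i - 1"] less.prems \<sigma>2 by (auto simp: p_def)
      have "\<not> \<sigma> i \<le> i"
      proof
        assume le: "\<sigma> i \<le> i"
        have "\<sigma> i \<notin> {1, 2, 3, 4}"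
          using fresh[OF block_last, of i] fresh[OF \<sigma>1, of i] fresh[OF \<sigma>2, of i] fresh[OF \<sigma>3, of i]
            less.prems by auto
        hence "5 \<le> \<sigma> i" using pos[of i] less.prems by auto
        hence "\<sigma> (\<sigma> i - 1) = \<sigma> i" using less.IH[of "\<sigma> i - 1"] le less.prems by auto
        hence "\<sigma> i - 1 = i" by (simp only: block_inj)
        thus False using le less.prems by auto
      qed
      moreover have "\<not> i + 1 < \<sigma> i"
      proof
        assume gt: "i + 1 < \<sigma> i"
        have p: "2 \<le> p" "p \<le> k" using less.prems by (auto simp: p_def)
        have "\<exists>q. 1 \<le> q \<and> q < p \<and> \<sigma> (\<sigma> q) = i + 1"
          by (rule block_next_value[OF \<sigma>1 p]) (use gt prev \<sigma>2 less.prems in auto)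
        then obtain q where q: "1 \<le> q" "q < p" "\<sigma> (\<sigma> q) = i + 1" by blast
        have "p \<le> i - 1" using less.prems by (auto simp: p_def)
        consider "q = 1" | "q = 2" | "q = 3" | "4 \<le> q" using q by linarith
        thus False
        proof cases
          case 1
          thus ?thesis using q \<sigma>1 \<sigma>2 less.prems by auto
        next
          case 2
          hence "4 < i" using q less.prems by (auto simp: p_def split: if_splits)
          hence "\<sigma> 4 = 5" using less.IH[of 4] less.prems by auto
          thus ?thesis using 2 q \<sigma>2 \<open>4 < i\<close> by auto
        next
          case 3
          thus ?thesis using q \<sigma>3 less.prems by auto
        next
          case 4
          have "\<sigma> q = q + 1" using less.IH[of q] q 4 \<open>p \<le> i - 1\<close> less.prems by auto
          moreover have "\<sigma> (q + 1) = q + 2" using less.IH[of "q + 1"] q 4 \<open>p \<le> i - 1\<close> less.prems by auto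
          ultimately show ?thesis using q \<open>p \<le> i - 1\<close> by auto
        qed
      qed
      ultimately show ?case by linarith
    qed
    have "\<sigma> i = twisted_block k i" for i
    proof -
      consider "i = 1" | "i = 2" | "i = 3" | "4 \<le> i" "i < k" | "i = k" | "i \<notin> {1..k}" by force
      thus ?thesis using \<sigma>1 \<sigma>2 \<sigma>3 shift[of i] block_last outside[of i] k5
        by cases (auto simp: twisted_block_def cyclic_block_def)
    qed
    thus ?thesis by auto
  qed
qed

lemma leading_block_classification: "\<sigma> = cyclic_block k \<or> \<sigma> = twisted_block k"
  using block_first block_first_2 block_first_3 by blast

end

text \<open>
  For \<open>k \<le> 2\<close> the last entry determines the block; for larger \<open>k\<close> the classification applies.
\<close>

lemma card_leading_blocks_square_no_132:
  assumes k: "1 \<le> k"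
  shows "card {\<sigma> \<in> leading_blocks k. \<not> has_132 k (\<sigma> \<circ> \<sigma>)} = (if k \<le> 2 then 1 else 2)"
proof (cases "k \<le> 2")
  case True
  have "\<sigma> = cyclic_block k" if "\<sigma> \<in> leading_blocks k" for \<sigma>
  proof
    fix i
    have perm: "\<sigma> permutes {1..k}" and last: "\<sigma> k = 1"
      using that by (auto simp: leading_blocks_def avoiders_def)
    consider "i \<notin> {1..k}" | "i = k" | "i = 1" "k = 2" using True k by fastforce
    thus "\<sigma> i = cyclic_block k i"
    proof cases
      case 1
      thus ?thesis using permutes_not_in[OF perm, of i] k by (auto simp: cyclic_block_def)
    next
      case 2
      thus ?thesis using last by (simp add: cyclic_block_def)
    next
      case 3
      have "\<sigma> 1 \<noteq> \<sigma> 2" using permutes_inj[OF perm] by (simp add: inj_eq)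
      moreover have "\<sigma> 1 \<in> {1..2}" using permutes_in_image[OF perm, of 1] 3 by simp
      ultimately have "\<sigma> 1 = 2" using last 3 by (simp add: le_less_Suc_eq)
      thus ?thesis using 3 by (simp add: cyclic_block_def)
    qed
  qed
  hence "{\<sigma> \<in> leading_blocks k. \<not> has_132 k (\<sigma> \<circ> \<sigma>)} = {cyclic_block k}"
    using cyclic_block_in[OF k] by blast
  thus ?thesis using True by (simp only: card.insert) simp
next
  case False
  hence k3: "3 \<le> k" by simp
  have "{\<sigma> \<in> leading_blocks k. \<not> has_132 k (\<sigma> \<circ> \<sigma>)} = {cyclic_block k, twisted_block k}"
  proof (intro equalityI subsetI)
    fix \<sigma> assume "\<sigma> \<in> {\<sigma> \<in> leading_blocks k. \<not> has_132 k (\<sigma> \<circ> \<sigma>)}"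
    thus "\<sigma> \<in> {cyclic_block k, twisted_block k}" using leading_block_classification[OF k3] by simp
  next
    fix \<sigma> assume "\<sigma> \<in> {cyclic_block k, twisted_block k}"
    thus "\<sigma> \<in> {\<sigma> \<in> leading_blocks k. \<not> has_132 k (\<sigma> \<circ> \<sigma>)}"
      using cyclic_block_in[OF k] twisted_block_in[OF k3] by blast
  qed
  thus ?thesis using False cyclic_block_neq_twisted_block[OF k3] by (simp only: card_2_iff') simp
qed

section \<open>Summation\<close>

lemma sum_tribonacci: "2 * (\<Sum>j<Suc n. tribonacci j) + 1 = tribonacci (n + 2) + tribonacci n"
  by (induction n) (auto simp: numeral_2_eq_2)

text \<open>
  The weights are the numbers of admissible blocks of length \<open>k\<close>. Apart from the terms for \<open>k = 1\<close>
  and \<open>k = 2\<close>, the sum is twice an initial segment of the Tribonacci sequence.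
\<close>

lemma weighted_sum_tribonacci:
  assumes "1 \<le> n"
  shows "(\<Sum>k=1..n. (if k \<le> 2 then 1 else 2) * tribonacci (n - k + 2)) + 1 =
    tribonacci (n + 2) + tribonacci (n + 1)"
proof (cases "n = 1")
  case True
  thus ?thesis by (simp add: eval_nat_numeral)
next
  case False
  hence "n = Suc (Suc (n - 2))" using assms by linarith
  then obtain m where m: "n = Suc (Suc m)" by blast
  have split: "{1..n} = {1, 2} \<union> {3..n}" using m by auto
  have "(\<Sum>k=1..n. (if k \<le> 2 then 1 else 2) * tribonacci (n - k + 2)) =
    tribonacci (n + 1) + tribonacci n + (\<Sum>k=3..n. 2 * tribonacci (n - k + 2))"
    unfolding split by (subst sum.union_disjoint) (auto simp: m intro!: sum.cong)
  also have "(\<Sum>k=3..n. 2 * tribonacci (n - k + 2)) = 2 * (\<Sum>j=2..<n. tribonacci j)"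
    unfolding sum_distrib_left
    by (rule sum.reindex_bij_witness[of _ "\<lambda>j. n + 2 - j" "\<lambda>k. n - k + 2"]) auto
  also have "(\<Sum>j=2..<n. tribonacci j) = (\<Sum>j<n. tribonacci j)"
    by (rule sum.mono_neutral_left) (auto simp: not_le less_2_cases_iff)
  finally show ?thesis using sum_tribonacci[of "Suc m"] m by (simp add: numeral_2_eq_2)
qed

lemma count_avoid_sq_eq_card:
  "count_avoid_sq n {[3, 1, 2], [4, 3, 2, 1]} [1, 3, 2] =
    card {\<pi> \<in> avoiders n. \<not> has_132 n (\<pi> \<circ> \<pi>)}"
  unfolding count_avoid_sq_def avoiders_def
  by (simp only: ball_simps contains_132_iff contains_312_iff contains_4321_iff
      mem_Collect_eq conj_assoc simp_thms)

theorem theorem4p2: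
  fixes n :: nat
  assumes "n \<ge> 1"
  shows "int (count_avoid_sq n {[3, 1, 2], [4, 3, 2, 1]} [1, 3, 2]) =
         int (tribonacci (n + 2)) + int (tribonacci (n + 1)) - 1"
proof -
  have "card {\<pi> \<in> avoiders n. \<not> has_132 n (\<pi> \<circ> \<pi>)} =
    (\<Sum>k=1..n. card {\<sigma> \<in> leading_blocks k. \<not> has_132 k (\<sigma> \<circ> \<sigma>)} *
      card {\<tau> \<in> avoiders (n - k). \<tau> \<circ> \<tau> = id})"
  proof (rule card_avoiders_by_leading_block[OF assms])
    fix k \<sigma> \<tau>
    assume h: "1 \<le> k" "k \<le> n" "\<sigma> \<in> leading_blocks k" "\<tau> \<in> avoiders (n - k)"
    hence p: "\<sigma> permutes {1..k}" "\<tau> permutes {1..n - k}"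
      by (auto simp: leading_blocks_def avoiders_def)
    have "has_132 (k + (n - k)) (direct_sum k \<sigma> \<tau> \<circ> direct_sum k \<sigma> \<tau>) \<longleftrightarrow>
        has_132 k (\<sigma> \<circ> \<sigma>) \<or> \<tau> \<circ> \<tau> \<noteq> id"
      unfolding direct_sum_square[OF p]
      by (rule has_132_direct_sum[OF permutes_compose[OF p(1) p(1)] permutes_compose[OF p(2) p(2)] h(1)])
    thus "\<not> has_132 n (direct_sum k \<sigma> \<tau> \<circ> direct_sum k \<sigma> \<tau>) \<longleftrightarrow>
        \<not> has_132 k (\<sigma> \<circ> \<sigma>) \<and> \<tau> \<circ> \<tau> = id"
      using h(2) by (simp only: le_add_diff_inverse) blast
  qed
  also have "\<dots> = (\<Sum>k=1..n. (if k \<le> 2 then 1 else 2) * tribonacci (n - k + 2))"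
    by (intro sum.cong refl)
      (simp only: card_leading_blocks_square_no_132 card_involutive_avoiders atLeastAtMost_iff)
  finally have "count_avoid_sq n {[3, 1, 2], [4, 3, 2, 1]} [1, 3, 2] + 1 =
      tribonacci (n + 2) + tribonacci (n + 1)"
    using weighted_sum_tribonacci[OF assms] count_avoid_sq_eq_card by simp
  thus ?thesis by linarith
qed

end
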